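(* Let $G$ be a connected loopless graph (parallel edges allowed) and $k$ a positive integer with $|E(G)|=k(|V(G)|-1)$. Fix an orientation of the edges of $G$. Then the permanent modulo $k+1$ of the $k$DSI matrix of $G$ (with respect to this orientation) does not depend on the choice of special vertex; that is, for any two vertices $u,w$, the $k$DSI matrices $M_u,M_w$ with special vertices $u,w$ satisfy $\mathrm{Perm}(M_u)\equiv\mathrm{Perm}(M_w)\pmod{k+1}$.
   Context: Given a graph $G$ with a fixed orientation of its edges, its signed incidence matrix $M^*$ has rows indexed by vertices and columns by edges, with entry $1$ if the vertex is the tail of the edge, $-1$ if it is the head, and $0$ otherwise. For a chosen vertex $w$ (the special vertex), let $M$ be $M^*$ with the row of $w$ deleted. The $k$DSI matrix of $G$ with special vertex $w$ is the block matrix obtained by stacking $k$ copies of $M$ vertically. The permanent of an $n\times n$ matrix $A$ is $\mathrm{Perm}(A)=\sum_{\sigma\in S_n}\prod_i a_{i,\sigma(i)}$. *)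

theory Defs
  imports
    "Jordan_Normal_Form.Matrix"
    "Graph_Theory.Digraph_Component"
    "HOL-Combinatorics.Permutations"
    "HOL-Number_Theory.Cong"
begin

text \<open>
  A loopless multigraph together with a fixed orientation of its edges is a
  \<^locale>\<open>loopfree_digraph\<close>: its arcs are the edges, each with the chosen tail and head, and
  several arcs may have the same ends. Matrices have rows and columns numbered by natural
  numbers, so a matrix of \<open>G\<close> is taken with respect to a list \<open>vs\<close> enumerating the vertices
  and a list \<open>es\<close> enumerating the edges.
\<close>

definition permanent :: "'a :: comm_ring_1 mat \<Rightarrow> 'a" where
  "permanent A = (if dim_row A = dim_col A
     then (\<Sum>\<sigma> | \<sigma> permutes {0..<dim_row A}. \<Prod>i = 0..<dim_row A. A $$ (i, \<sigma> i))
     else 0)"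

definition signed_incidence_mat :: "('v, 'e) pre_digraph \<Rightarrow> 'v list \<Rightarrow> 'e list \<Rightarrow> int mat" where
  "signed_incidence_mat G vs es = mat (length vs) (length es)
     (\<lambda>(i, j). if vs ! i = tail G (es ! j) then 1
              else if vs ! i = head G (es ! j) then - 1
              else 0)"

definition reduced_incidence_mat ::
    "('v, 'e) pre_digraph \<Rightarrow> 'v list \<Rightarrow> 'e list \<Rightarrow> 'v \<Rightarrow> int mat" where
  "reduced_incidence_mat G vs es w = mat_of_rows (length es)
     [row (signed_incidence_mat G vs es) i. i \<leftarrow> [0..<length vs], vs ! i \<noteq> w]"

primrec stack_copies :: "nat \<Rightarrow> 'a :: zero mat \<Rightarrow> 'a mat" where
  "stack_copies 0 A = 0\<^sub>m 0 (dim_col A)"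
| "stack_copies (Suc k) A = A @\<^sub>r stack_copies k A"

definition kDSI_mat ::
    "nat \<Rightarrow> ('v, 'e) pre_digraph \<Rightarrow> 'v list \<Rightarrow> 'e list \<Rightarrow> 'v \<Rightarrow> int mat" where
  "kDSI_mat k G vs es w = stack_copies k (reduced_incidence_mat G vs es w)"

end

theory Submission
  imports Defs
begin

text \<open>
  The columns of the full incidence matrix sum to zero, so in a stacked matrix one row of \<open>u\<close> may
  be replaced by minus the sum of the rows of all other vertices. The rows of a vertex other than
  \<open>u\<close> and \<open>w\<close> then occur \<open>k + 1\<close> times, and the permanent of a matrix with \<open>m\<close> equal rows is
  divisible by \<open>m!\<close>; hence modulo \<open>k + 1\<close>, trading one row of \<open>u\<close> for one of \<open>w\<close> negates the
  permanent. Trading all \<open>k\<close> rows gives the sign \<open>(-1)^k\<close>, which is harmless for odd \<open>k\<close> as well,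
  because the permanent is divisible by \<open>k!\<close> and \<open>k + 1\<close> divides \<open>2 k!\<close>.
\<close>

section \<open>Permanents of matrices given by lists of row labels\<close>

text \<open>Rows are named by labels, \<open>B v\<close> being the row of \<open>v\<close>, so that
  equal rows show up as repeated entries of \<open>xs\<close> and row operations become operations
  on lists.\<close>

definition perm_rows :: "('v \<Rightarrow> nat \<Rightarrow> 'a :: comm_ring_1) \<Rightarrow> 'v list \<Rightarrow> 'a" where
  "perm_rows B xs = (\<Sum>\<sigma> | \<sigma> permutes {..<length xs}. \<Prod>i<length xs. B (xs ! i) (\<sigma> i))"

text \<open>Reordering the rows by \<open>p\<close> is absorbed by reindexing the sum along \<sigma>
  \<mapsto> \<open>\<sigma> \<circ> p\<close>. Hence only multiplicities of rows matter from here
  on.\<close>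

lemma perm_rows_mset_cong:
  assumes "mset xs = mset ys"
  shows "perm_rows B xs = perm_rows B ys"
proof -
  obtain p where p: "p permutes {..<length ys}" and xs: "permute_list p ys = xs"
    using assms by (rule mset_eq_permutation)
  have "perm_rows B xs =
      (\<Sum>\<sigma> | \<sigma> permutes {..<length ys}. \<Prod>i<length ys. B (ys ! p i) (\<sigma> i))"
    using permute_list_nth[OF p] xs by (auto simp: perm_rows_def intro!: sum.cong prod.cong)
  also have "\<dots> = (\<Sum>\<sigma> | \<sigma> permutes {..<length ys}. \<Prod>i<length ys. B (ys ! p i) ((\<sigma> \<circ> p) i))"
    by (rule sum_permutations_compose_right[OF p])
  also have "\<dots> = perm_rows B ys"
    unfolding perm_rows_def
    by (intro sum.cong refl, subst (2) prod.permute[OF p]) (simp add: comp_def)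
  finally show ?thesis .
qed

text \<open>The permanent is linear in its first row, and the first rows in question add up to the
  zero row.\<close>

lemma sum_perm_rows_Cons_eq_0:
  assumes "\<And>j. j < Suc (length xs) \<Longrightarrow> (\<Sum>v\<in>V. B v j) = 0"
  shows "(\<Sum>v\<in>V. perm_rows B (v # xs)) = 0"
proof -
  let ?n = "Suc (length xs)"
  have "(\<Sum>v\<in>V. perm_rows B (v # xs)) =
      (\<Sum>\<sigma> | \<sigma> permutes {..<?n}. \<Sum>v\<in>V. B v (\<sigma> 0) * (\<Prod>i<length xs. B (xs ! i) (\<sigma> (Suc i))))"
    unfolding perm_rows_def
    by (subst sum.swap) (simp add: prod.lessThan_Suc_shift del: prod.lessThan_Suc)
  also have "\<dots> = 0"
  proof (rule sum.neutral, rule ballI)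
    fix \<sigma> assume "\<sigma> \<in> {\<sigma>. \<sigma> permutes {..<?n}}"
    then have "\<sigma> 0 < ?n"
      using permutes_in_image[of \<sigma> "{..<?n}" 0] by simp
    then show "(\<Sum>v\<in>V. B v (\<sigma> 0) * (\<Prod>i<length xs. B (xs ! i) (\<sigma> (Suc i)))) = 0"
      by (simp add: assms flip: sum_distrib_right)
  qed
  finally show ?thesis .
qed

text \<open>The permutations of the positions of \<open>v\<close> act freely on the summands and preserve them.\<close>

lemma fact_count_dvd_perm_rows:
  "fact (count (mset xs) v) dvd perm_rows B xs"
proof -
  let ?I = "{..<length xs}"
  let ?A = "{i. i < length xs \<and> xs ! i = v}"
  let ?P = "{\<sigma>. \<sigma> permutes ?I}"
  define F where "F \<sigma> = (\<Prod>i<length xs. B (xs ! i) (\<sigma> i))" for \<sigma>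
  \<comment> \<open>\<open>h\<close> forgets the values of \<sigma> at the positions of
    \<open>v\<close>, with \<open>undefined\<close> as a mere placeholder. Its fibres are the orbits
    of the action, which is composition on the right.\<close>
  define h where "h \<sigma> = (\<lambda>i. if i \<in> ?A then undefined else \<sigma> i)" for \<sigma> :: "nat \<Rightarrow> nat"
  have card_A: "card ?A = count (mset xs) v"
    by (simp add: count_mset count_list_eq_length_filter length_filter_conv_card eq_commute)
  have F_comp: "F (\<sigma> \<circ> \<tau>) = F \<sigma>" if \<tau>: "\<tau> permutes ?A" for \<sigma> \<tau>
  proof -
    have "\<tau> permutes ?I"
      using \<tau> by (rule permutes_subset) auto
    moreover have "xs ! \<tau> i = xs ! i" for i
      using permutes_in_image[OF \<tau>, of i] permutes_not_in[OF \<tau>, of i] by (cases "i \<in> ?A") auto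
    ultimately show ?thesis
      unfolding F_def by (subst (2) prod.permute[where p = \<tau>]) (simp_all add: comp_def)
  qed
  have fiber: "{\<sigma>' \<in> ?P. h \<sigma>' = h \<sigma>} = (\<lambda>\<tau>. \<sigma> \<circ> \<tau>) ` {\<tau>. \<tau> permutes ?A}" if \<sigma>: "\<sigma> permutes ?I" for \<sigma>
  proof (intro equalityI subsetI)
    fix \<sigma>' assume "\<sigma>' \<in> {\<sigma>' \<in> ?P. h \<sigma>' = h \<sigma>}"
    then have \<sigma>': "\<sigma>' permutes ?I" and eq: "h \<sigma>' = h \<sigma>"
      by auto
    \<comment> \<open>The only candidate for \<tau> is the quotient of the two permutations. It
      fixes every position outside \<open>?A\<close>, because \<sigma> and \<open>\<sigma>'\<close>
      agree there.\<close>
    have "inv_into UNIV \<sigma> \<circ> \<sigma>' permutes ?I"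
      using \<sigma> \<sigma>' by (simp add: permutes_compose permutes_inv)
    moreover have "(inv_into UNIV \<sigma> \<circ> \<sigma>') i = i" if "i \<in> ?I - ?A" for i
      using fun_cong[OF eq, of i] that permutes_inverses(2)[OF \<sigma>] by (auto simp: h_def)
    ultimately have "inv_into UNIV \<sigma> \<circ> \<sigma>' permutes ?A"
      by (rule permutes_superset) auto
    moreover have "\<sigma>' = \<sigma> \<circ> (inv_into UNIV \<sigma> \<circ> \<sigma>')"
      using permutes_inverses(1)[OF \<sigma>] by (auto simp: fun_eq_iff)
    ultimately show "\<sigma>' \<in> (\<lambda>\<tau>. \<sigma> \<circ> \<tau>) ` {\<tau>. \<tau> permutes ?A}"
      by blast
  next
    fix \<sigma>' assume "\<sigma>' \<in> (\<lambda>\<tau>. \<sigma> \<circ> \<tau>) ` {\<tau>. \<tau> permutes ?A}"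
    then obtain \<tau> where \<tau>: "\<tau> permutes ?A" and \<sigma>': "\<sigma>' = \<sigma> \<circ> \<tau>"
      by blast
    have "\<tau> permutes ?I"
      using \<tau> by (rule permutes_subset) auto
    then have "\<sigma>' permutes ?I"
      unfolding \<sigma>' using \<sigma> by (rule permutes_compose)
    moreover have "h \<sigma>' = h \<sigma>"
      using permutes_not_in[OF \<tau>] by (auto simp: h_def \<sigma>' fun_eq_iff)
    ultimately show "\<sigma>' \<in> {\<sigma>' \<in> ?P. h \<sigma>' = h \<sigma>}"
      by simp
  qed
  have "fact (count (mset xs) v) dvd (\<Sum>\<sigma>' \<in> {\<sigma>' \<in> ?P. h \<sigma>' = h \<sigma>}. F \<sigma>')"
    if \<sigma>: "\<sigma> permutes ?I" for \<sigma>
  proof -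
    have "inj_on (\<lambda>\<tau>. \<sigma> \<circ> \<tau>) {\<tau>. \<tau> permutes ?A}"
      using fun.inj_map[OF permutes_inj[OF \<sigma>]] by (rule inj_on_subset) simp
    then have "(\<Sum>\<sigma>' \<in> {\<sigma>' \<in> ?P. h \<sigma>' = h \<sigma>}. F \<sigma>') = (\<Sum>\<tau> | \<tau> permutes ?A. F \<sigma>)"
      unfolding fiber[OF \<sigma>] by (subst sum.reindex) (simp_all add: F_comp)
    also have "\<dots> = fact (count (mset xs) v) * F \<sigma>"
      using card_permutations[OF card_A] by simp
    finally show ?thesis
      by simp
  qed
  \<comment> \<open>Grouping the permanent by the fibres of \<open>h\<close> writes it as a sum of
    multiples of the factorial.\<close>
  then have "fact (count (mset xs) v) dvd (\<Sum>y \<in> h ` ?P. \<Sum>\<sigma>' \<in> {\<sigma>' \<in> ?P. h \<sigma>' = y}. F \<sigma>')"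
    by - (rule dvd_sum, auto)
  also have "\<dots> = perm_rows B xs"
    unfolding perm_rows_def F_def[symmetric]
    by (rule sum.image_gen[symmetric]) (simp add: finite_permutations)
  finally show ?thesis .
qed

section \<open>Trading rows of \<open>u\<close> for rows of \<open>w\<close> modulo
  \<open>k + 1\<close>\<close>

text \<open>The multiplicities of \<open>u\<close> and \<open>w\<close> in \<open>xs\<close> are
  left free, since they change during repeated trading while those of the other labels stay at
  \<open>k\<close>.\<close>

lemma cong_perm_rows_exchange_one:
  fixes B :: "'v \<Rightarrow> nat \<Rightarrow> int"
  assumes "finite V" "u \<in> V" "w \<in> V" "u \<noteq> w"
    and count_xs: "\<And>v. v \<in> V - {u, w} \<Longrightarrow> count (mset xs) v = k"
    and col_sum: "\<And>j. j < Suc (length xs) \<Longrightarrow> (\<Sum>v\<in>V. B v j) = 0"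
  shows "[perm_rows B (u # xs) = - perm_rows B (w # xs)] (mod (int k + 1))"
proof -
  \<comment> \<open>The new first row is copy number \<open>k + 1\<close> of \<open>v\<close>, so
    \<open>fact (Suc k)\<close> divides the permanent.\<close>
  have "int k + 1 dvd perm_rows B (v # xs)" if v: "v \<in> V - {u, w}" for v
  proof -
    have "int k + 1 dvd fact (Suc k)"
      by (simp add: add.commute)
    also have "fact (Suc k) dvd perm_rows B (v # xs)"
      using fact_count_dvd_perm_rows[of "v # xs" v B] count_xs[OF v] by simp
    finally show ?thesis .
  qed
  then have "int k + 1 dvd (\<Sum>v \<in> V - {u, w}. perm_rows B (v # xs))"
    by (rule dvd_sum)
  moreover have "(\<Sum>v \<in> V - {u, w}. perm_rows B (v # xs)) =
      - (perm_rows B (u # xs) - - perm_rows B (w # xs))"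
  proof -
    have "(\<Sum>v\<in>V. perm_rows B (v # xs)) =
        (\<Sum>v \<in> V - {u, w}. perm_rows B (v # xs)) + (\<Sum>v \<in> {u, w}. perm_rows B (v # xs))"
      using assms(1-3) by (intro sum.subset_diff) auto
    then show ?thesis
      using sum_perm_rows_Cons_eq_0[where B = B and V = V and xs = xs] col_sum \<open>u \<noteq> w\<close> by simp
  qed
  ultimately show ?thesis
    by (simp only: cong_iff_dvd_diff dvd_minus_iff)
qed

text \<open>Each trade contributes one sign. The number \<open>m\<close> of rows of \<open>w\<close>
  already obtained varies in the induction, as it grows while \<open>i\<close> shrinks.\<close>

lemma cong_perm_rows_exchange:
  fixes B :: "'v \<Rightarrow> nat \<Rightarrow> int"
  assumes "finite V" "u \<in> V" "w \<in> V" "u \<noteq> w"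
    and count_zs: "\<And>v. v \<in> V - {u, w} \<Longrightarrow> count (mset zs) v = k"
    and col_sum: "\<And>j. j < i + m + length zs \<Longrightarrow> (\<Sum>v\<in>V. B v j) = 0"
  shows "[perm_rows B (replicate i u @ replicate m w @ zs) =
      (- 1) ^ i * perm_rows B (replicate (i + m) w @ zs)] (mod (int k + 1))"
  using col_sum
proof (induction i arbitrary: m)
  case 0
  then show ?case by simp
next
  case (Suc i)
  let ?xs = "replicate i u @ replicate m w @ zs"
  have "[perm_rows B (u # ?xs) = - perm_rows B (w # ?xs)] (mod (int k + 1))"
    using assms(1-4) count_zs Suc.prems by (intro cong_perm_rows_exchange_one) auto
  also have "perm_rows B (w # ?xs) = perm_rows B (replicate i u @ replicate (Suc m) w @ zs)"
    by (rule perm_rows_mset_cong) simp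
  also have "[- perm_rows B (replicate i u @ replicate (Suc m) w @ zs) =
      - ((- 1) ^ i * perm_rows B (replicate (i + Suc m) w @ zs))] (mod (int k + 1))"
    using Suc.IH[of "Suc m"] Suc.prems by (simp add: cong_minus_minus_iff)
  finally show ?case
    by simp
qed

text \<open>For \<open>k = 2 * m + 1\<close> one has \<open>k + 1 = 2 * Suc m\<close>, and
  \<open>Suc m\<close> is at most \<open>k\<close>. The factor 2 is essential: 4 does not divide
  3!.\<close>

lemma Suc_dvd_two_times_fact:
  assumes "odd k"
  shows "int k + 1 dvd 2 * fact k"
proof -
  obtain m where k: "k = 2 * m + 1"
    using assms by (rule oddE)
  have "Suc m dvd fact k"
    using k by (intro dvd_fact) auto
  then have "int (Suc m) dvd fact k"
    by (metis of_nat_dvd_iff of_nat_fact)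
  then have "2 * int (Suc m) dvd 2 * fact k"
    by (rule mult_dvd_mono[OF dvd_refl])
  then show ?thesis
    by (simp add: k algebra_simps)
qed

lemma cong_perm_rows_replace_all:
  fixes B :: "'v \<Rightarrow> nat \<Rightarrow> int"
  assumes "finite V" "u \<in> V" "w \<in> V" "u \<noteq> w"
    and "\<And>v. v \<in> V - {u, w} \<Longrightarrow> count (mset zs) v = k"
    and "count (mset zs) w = 0"
    and "\<And>j. j < k + length zs \<Longrightarrow> (\<Sum>v\<in>V. B v j) = 0"
  shows "[perm_rows B (replicate k u @ zs) = perm_rows B (replicate k w @ zs)] (mod (int k + 1))"
proof -
  let ?p = "perm_rows B (replicate k w @ zs)"
  have "[perm_rows B (replicate k u @ zs) = (- 1) ^ k * ?p] (mod (int k + 1))"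
    using cong_perm_rows_exchange[where i = k and m = 0] assms by fastforce
  also have "[(- 1) ^ k * ?p = ?p] (mod (int k + 1))"
  proof (cases "even k")
    case True
    then show ?thesis by simp
  next
    case False
    \<comment> \<open>The label \<open>w\<close> occurs exactly \<open>k\<close> times, as
      \<open>zs\<close> does not contain it. The two sides of the congruence differ by
      \<open>- (2 * ?p)\<close>.\<close>
    have "fact k dvd ?p"
      using fact_count_dvd_perm_rows[of "replicate k w @ zs" w B] assms(6) by simp
    then have "2 * fact k dvd 2 * ?p"
      by (rule mult_dvd_mono[OF dvd_refl])
    then have "int k + 1 dvd 2 * ?p"
      using Suc_dvd_two_times_fact[OF False] dvd_trans by blast
    then have "int k + 1 dvd - (2 * ?p)"
      by simp
    then show ?thesis
      using False by (simp add: cong_iff_dvd_diff)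
  qed
  finally show ?thesis .
qed

section \<open>Stacked matrices as lists of rows\<close>

lemma append_rows_mat_of_rows:
  assumes "set rs \<subseteq> carrier_vec n" "set rs' \<subseteq> carrier_vec n"
  shows "mat_of_rows n rs @\<^sub>r mat_of_rows n rs' = mat_of_rows n (rs @ rs')"
  by (rule eq_matI) (auto simp: append_rows_def mat_of_rows_index nth_append)

lemma stack_copies_mat_of_rows:
  assumes "set rs \<subseteq> carrier_vec n"
  shows "stack_copies k (mat_of_rows n rs) = mat_of_rows n (concat (replicate k rs))"
proof (induction k)
  case 0
  then show ?case by (auto intro!: eq_matI)
next
  case (Suc k)
  have "set (concat (replicate k rs)) \<subseteq> carrier_vec n"
    using assms by auto
  then show ?case
    using Suc assms by (simp add: append_rows_mat_of_rows)
qed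

lemma permanent_mat_of_rows:
  assumes "length xs = n"
  shows "permanent (mat_of_rows n (map (\<lambda>x. vec n (B x)) xs)) = perm_rows B xs"
  using assms permutes_in_image[where S = "{..<n}"]
  by (auto simp: permanent_def perm_rows_def mat_of_rows_index atLeast0LessThan intro!: sum.cong prod.cong)

text \<open>The left-hand side is the unfolded form of a guarded list comprehension over indices, as
  in \<open>reduced_incidence_mat\<close>.\<close>

lemma concat_map_upt_nth_filter:
  "concat (map (\<lambda>i. if P (xs ! i) then [g (xs ! i)] else []) [0..<length xs]) = map g (filter P xs)"
proof -
  have "concat (map (\<lambda>x. if P x then [g x] else []) xs) = map g (filter P xs)"
    by (induction xs) auto
  then show ?thesis
    by (subst (asm) (1) map_nth[symmetric]) (simp only: map_map comp_def)
qed

section \<open>Incidence matrices and the kDSI matrix\<close>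

definition incidence_entry :: "('v, 'e) pre_digraph \<Rightarrow> 'e list \<Rightarrow> 'v \<Rightarrow> nat \<Rightarrow> int" where
  "incidence_entry G es v j =
    (if v = tail G (es ! j) then 1 else if v = head G (es ! j) then - 1 else 0)"

text \<open>Without loops, tail and head are distinct, so the column contains exactly one 1 and one
  -1.\<close>

lemma sum_incidence_entry:
  assumes "loopfree_digraph G" "finite (verts G)" "set es = arcs G" "j < length es"
  shows "(\<Sum>v\<in>verts G. incidence_entry G es v j) = 0"
proof -
  interpret loopfree_digraph G by fact
  let ?t = "tail G (es ! j)" and ?h = "head G (es ! j)"
  have "es ! j \<in> arcs G"
    using assms(3,4) nth_mem by blast
  then have *: "?t \<in> verts G" "?h \<in> verts G" "?t \<noteq> ?h"
    using no_loops by auto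
  have "(\<Sum>v\<in>verts G. incidence_entry G es v j) = (\<Sum>v\<in>{?t, ?h}. incidence_entry G es v j)"
    using * assms(2) by (intro sum.mono_neutral_right) (auto simp: incidence_entry_def)
  also have "\<dots> = 0"
    using * by (simp add: incidence_entry_def)
  finally show ?thesis .
qed

lemma reduced_incidence_mat_eq:
  "reduced_incidence_mat G vs es w =
    mat_of_rows (length es) (map (\<lambda>v. vec (length es) (incidence_entry G es v)) (filter (\<lambda>v. v \<noteq> w) vs))"
proof -
  let ?r = "\<lambda>v. vec (length es) (incidence_entry G es v)"
  have "[row (signed_incidence_mat G vs es) i. i \<leftarrow> [0..<length vs], vs ! i \<noteq> w] =
      concat (map (\<lambda>i. if vs ! i \<noteq> w then [?r (vs ! i)] else []) [0..<length vs])"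
    by (intro arg_cong[where f = concat] map_cong refl)
      (auto simp: signed_incidence_mat_def incidence_entry_def)
  then show ?thesis
    unfolding reduced_incidence_mat_def
    using concat_map_upt_nth_filter[of "\<lambda>v. v \<noteq> w" vs ?r] by simp
qed

text \<open>The hypothesis says that the stacked matrix is square; otherwise
  \<open>permanent\<close> returns 0 by definition.\<close>

lemma permanent_kDSI_mat:
  assumes "k * length (filter (\<lambda>v. v \<noteq> w) vs) = length es"
  shows "permanent (kDSI_mat k G vs es w) =
    perm_rows (incidence_entry G es) (concat (replicate k (filter (\<lambda>v. v \<noteq> w) vs)))"
proof -
  let ?r = "\<lambda>v. vec (length es) (incidence_entry G es v)"
  let ?ws = "filter (\<lambda>v. v \<noteq> w) vs"
  have "kDSI_mat k G vs es w = mat_of_rows (length es) (concat (replicate k (map ?r ?ws)))"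
    unfolding kDSI_mat_def reduced_incidence_mat_eq by (rule stack_copies_mat_of_rows) auto
  also have "concat (replicate k (map ?r ?ws)) = map ?r (concat (replicate k ?ws))"
    by (simp add: map_concat)
  also have "permanent (mat_of_rows (length es) \<dots>) = perm_rows (incidence_entry G es) (concat (replicate k ?ws))"
    by (rule permanent_mat_of_rows) (use assms in \<open>simp add: length_concat sum_list_replicate\<close>)
  finally show ?thesis .
qed

lemma count_concat_replicate:
  "count (mset (concat (replicate k xs))) v = k * count (mset xs) v"
  by (induction k) auto

text \<open>Gathers the copies of \<open>u\<close>, one from each block, at the front; what follows
  is symmetric in \<open>u\<close> and \<open>w\<close>.\<close>

lemma mset_concat_replicate_filter_neq:
  assumes "distinct vs" "u \<in> set vs" "u \<noteq> w"
  shows "mset (concat (replicate k (filter (\<lambda>v. v \<noteq> w) vs))) =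
    mset (replicate k u @ concat (replicate k (filter (\<lambda>v. v \<noteq> u \<and> v \<noteq> w) vs)))"
  using assms
  by (intro multiset_eqI) (auto simp: count_concat_replicate distinct_count_atmost_1)

theorem theorem2p9:
  fixes G :: "('v, 'e) pre_digraph" and k :: nat and vs :: "'v list" and es :: "'e list"
    and u w :: 'v
  assumes "fin_digraph G" and "loopfree_digraph G" and "Digraph_Component.connected G"
    and "k > 0"
    and "card (arcs G) = k * (card (verts G) - 1)"
    and "distinct vs" and "set vs = verts G"
    and "distinct es" and "set es = arcs G"
    and "u \<in> verts G" and "w \<in> verts G"
  shows "[permanent (kDSI_mat k G vs es u) = permanent (kDSI_mat k G vs es w)] (mod (int k + 1))"
proof (cases "u = w")
  case True
  then show ?thesis by simp
next
  case False
  let ?B = "incidence_entry G es"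
  define zs where "zs = concat (replicate k (filter (\<lambda>v. v \<noteq> u \<and> v \<noteq> w) vs))"
  have fin: "finite (verts G)"
    using assms(7) by (metis List.finite_set)
  have len_filter: "length (filter (\<lambda>v. v \<noteq> x) vs) = card (verts G) - 1" if "x \<in> verts G" for x
  proof -
    have "length (filter (\<lambda>v. v \<noteq> x) vs) = card (set vs - {x})"
      using assms(6) distinct_card[of "filter (\<lambda>v. v \<noteq> x) vs"] by (simp add: set_diff_eq)
    then show ?thesis
      using assms(7) that by simp
  qed
  have len_es: "length es = k * (card (verts G) - 1)"
    using assms(5,8,9) distinct_card by metis
  \<comment> \<open>The roles cross over: deleting the row of \<open>w\<close> keeps the
    \<open>k\<close> copies of \<open>u\<close>, and conversely. The rows \<open>zs\<close> are
    common to both matrices.\<close>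
  have perm_w: "permanent (kDSI_mat k G vs es w) = perm_rows ?B (replicate k u @ zs)"
    and len_zs: "k + length zs = length es"
  proof -
    have m: "mset (concat (replicate k (filter (\<lambda>v. v \<noteq> w) vs))) = mset (replicate k u @ zs)"
      unfolding zs_def using assms False by (intro mset_concat_replicate_filter_neq) auto
    show "permanent (kDSI_mat k G vs es w) = perm_rows ?B (replicate k u @ zs)"
      using assms len_es len_filter perm_rows_mset_cong[OF m] by (simp add: permanent_kDSI_mat)
    show "k + length zs = length es"
      using mset_eq_length[OF m] assms len_es len_filter
      by (simp add: length_concat sum_list_replicate)
  qed
  have perm_u: "permanent (kDSI_mat k G vs es u) = perm_rows ?B (replicate k w @ zs)"
  proof -
    have m: "mset (concat (replicate k (filter (\<lambda>v. v \<noteq> u) vs))) = mset (replicate k w @ zs)"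
      unfolding zs_def using assms False mset_concat_replicate_filter_neq[of vs w u k]
      by (simp add: conj_commute)
    show ?thesis
      using assms len_es len_filter perm_rows_mset_cong[OF m] by (simp add: permanent_kDSI_mat)
  qed
  have "[perm_rows ?B (replicate k u @ zs) = perm_rows ?B (replicate k w @ zs)] (mod (int k + 1))"
  proof (rule cong_perm_rows_replace_all)
    show "count (mset zs) v = k" if "v \<in> verts G - {u, w}" for v
      using that assms by (simp add: zs_def count_concat_replicate distinct_count_atmost_1)
    show "count (mset zs) w = 0"
      by (simp add: zs_def count_concat_replicate)
    show "(\<Sum>v\<in>verts G. ?B v j) = 0" if "j < k + length zs" for j
      using that len_zs assms fin by (intro sum_incidence_entry) auto
  qed (use fin assms False in auto)
  then show ?thesis
    unfolding perm_u perm_w by (rule cong_sym)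
qed

end
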